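(* For all $n=0,1,2,\dots$, $$\frac{n!}{2^n\cdot 8}\leq \eta_n\leq n!.$$
   Context: For $n=0,1,2,\dots$, $\eta_n:=\int_0^{\infty}\frac{t^n}{(1+t)^2}e^{-t}\,dt$. *)

theory Defs
  imports "HOL-Analysis.Analysis"
begin

(* Lebesgue integral over the half-line. At n = 0 the factor t ^ 0 is 1, also at t = 0. *)
definition eta :: "nat \<Rightarrow> real" where
  "eta n = (LBINT t:{0..}. t ^ n / (1 + t)\<^sup>2 * exp (- t))"

end

theory Submission
  imports Defs "HOL-Probability.Distributions"
begin

text \<open>
  On the half-line, \<open>exp (- t) / 4 \<le> 1 / (1 + t)\<^sup>2 \<le> 1\<close>; the left inequality is the square of
  \<open>1 + t \<le> 2 (1 + t / 2) \<le> 2 exp (t / 2)\<close>. Integrating against \<open>t ^ n * exp (- t)\<close> bounds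
  \<open>eta n\<close> by Gamma integrals with rates 2 and 1.
\<close>

text \<open>Substituting \<open>c * t\<close> for \<open>t\<close> in the Gamma integral for n!: the
  Jacobian contributes one factor 1 / c, the monomial the other n.\<close>

lemma has_bochner_integral_power_times_exp:
  fixes c :: real
  assumes "c > 0"
  shows "has_bochner_integral lborel (\<lambda>t. indicator {0..} t * (t ^ n * exp (- (c * t))))
           (fact n / c ^ Suc n)"
proof -
  have "has_bochner_integral lborel (\<lambda>t::real. t ^ n * exp (- t) * indicator {0..} t) (fact n)"
  proof (rule has_bochner_integral_nn_integral)
    \<comment> \<open>The known Gamma integral is an nn-integral with the indicator outside
      \<open>ennreal\<close>; nonnegativity of the integrand lets it transfer.\<close>
    have "(\<integral>\<^sup>+t. ennreal (t ^ n * exp (- t) * indicator {0..} t) \<partial>lborel) =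
        (\<integral>\<^sup>+t. ennreal (t ^ n * exp (- t)) * indicator {0..} t \<partial>lborel)"
      by (intro nn_integral_cong) (simp add: indicator_def)
    then show "(\<integral>\<^sup>+t. ennreal (t ^ n * exp (- t) * indicator {0..} t) \<partial>lborel) = ennreal (fact n)"
      by (simp add: nn_intergal_power_times_exp_Ici)
  qed (auto simp: indicator_def)
  then have "has_bochner_integral lborel
      (\<lambda>t. (c * t) ^ n * exp (- (c * t)) * indicator {0..} (c * t)) (fact n / c)"
    using assms by (subst (asm) lborel_has_bochner_integral_real_affine_iff[of c _ _ 0])
      (simp_all add: divide_inverse mult_ac)
  \<comment> \<open>Since c > 0, the indicator at \<open>c * t\<close> equals the one at
    \<open>t\<close>, so only the factor \<open>c ^ n\<close> is left to cancel.\<close>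
  from has_bochner_integral_mult_right[OF this, of "1 / c ^ n"] assms
  show ?thesis
    by (simp add: power_mult_distrib indicator_def zero_le_mult_iff mult_ac cong: if_cong)
qed

lemma one_plus_squared_le_exp:
  fixes t :: real
  assumes "t \<ge> 0"
  shows "(1 + t)\<^sup>2 \<le> 4 * exp t"
proof -
  have "1 + t \<le> 2 * exp (t / 2)"
    using exp_ge_add_one_self[of "t / 2"] by linarith
  then have "(1 + t)\<^sup>2 \<le> (2 * exp (t / 2))\<^sup>2"
    using assms by (intro power_mono) auto
  then show ?thesis
    by (simp add: power_mult_distrib flip: exp_double)
qed

theorem proposition3p8:
  fixes n :: nat
  shows "fact n / (2 ^ n * 8) \<le> eta n \<and> eta n \<le> fact n"
proof -
  let ?g = "\<lambda>c t::real. indicator {0..} t * (t ^ n * exp (- (c * t)))"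
  let ?f = "\<lambda>t::real. indicator {0..} t * (t ^ n / (1 + t)\<^sup>2 * exp (- t))"
  note g1 = has_bochner_integral_power_times_exp[of 1 n, simplified]
  \<comment> \<open>Rate 2 gives n! / 2^(n+1); the further 4 turns this into n! / (2^n * 8).\<close>
  note g2 = has_bochner_integral_divide[OF has_bochner_integral_power_times_exp[of 2 n], of 4]
  have upper: "?f t \<le> ?g 1 t" for t
  proof (cases "t \<ge> 0")
    case True
    then have "t ^ n * exp (- t) / (1 + t)\<^sup>2 \<le> t ^ n * exp (- t) / 1"
      by (intro divide_left_mono) auto
    then show ?thesis
      using True by simp
  qed simp
  have lower: "?g 2 t / 4 \<le> ?f t" for t
  proof (cases "t \<ge> 0")
    case True
    \<comment> \<open>One \<open>exp (- t)\<close> is the weight in \<open>eta\<close>, the other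
      comes from the lower bound on 1 / (1 + t)^2; their product has rate 2.\<close>
    have "t ^ n * exp (- t) * (exp (- t) / 4) \<le> t ^ n * exp (- t) * (1 / (1 + t)\<^sup>2)"
      using one_plus_squared_le_exp[OF True] True
      by (intro mult_left_mono) (auto simp: exp_minus field_simps)
    then show ?thesis
      using True by (simp add: mult_ac flip: exp_add)
  qed simp
  \<comment> \<open>A non-integrable function has Bochner integral 0, so monotonicity requires
    integrability first; domination by \<open>?g 1\<close> supplies it.\<close>
  have f: "integrable lborel ?f"
  proof (rule Bochner_Integration.integrable_bound)
    show "integrable lborel (?g 1)"
      using g1 by (simp add: has_bochner_integral_iff)
    show "AE t in lborel. norm (?f t) \<le> norm (?g 1 t)"
    proof (rule AE_I2)
      fix t :: real
      show "norm (?f t) \<le> norm (?g 1 t)"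
        using upper[of t] by (auto simp: indicator_def abs_mult)
    qed
  qed simp
  have eta: "eta n = integral\<^sup>L lborel ?f"
    by (simp add: eta_def set_lebesgue_integral_def)
  have "integral\<^sup>L lborel (\<lambda>t. ?g 2 t / 4) \<le> integral\<^sup>L lborel ?f"
    using g2 f lower by (intro integral_mono) (auto simp: has_bochner_integral_iff)
  moreover have "integral\<^sup>L lborel ?f \<le> integral\<^sup>L lborel (?g 1)"
    using g1 f upper by (intro integral_mono) (auto simp: has_bochner_integral_iff)
  ultimately show ?thesis
    using g1 g2 eta by (simp add: has_bochner_integral_iff mult_ac)
qed

end
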